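(* A set $A\subseteq\mathbb{Z}^2$ is 8-connected if and only if $\Gamma^{*}(A)$ is connected in $\mathbb{K}^2$ (with the subspace topology).
   Context: Points $(x,y)\neq(x',y')$ of $\mathbb{Z}^2$ are 8-adjacent if $|x-x'|\le 1$ and $|y-y'|\le 1$. A subset $S\subseteq\mathbb{Z}^2$ is 8-connected if it cannot be partitioned into two nonempty subsets $P,Q$ such that no point of $P$ is 8-adjacent to a point of $Q$. The empty set is regarded as connected in every sense. $\mathbb{K}$ is $\mathbb{Z}$ with the Khalimsky topology, generated by the sets $N(n)=\{n\}$ for $n$ odd and $N(n)=\{n-1,n,n+1\}$ for $n$ even; $\mathbb{K}^2$ has the product topology. For $x\in\mathbb{K}^2$, $N(x)$ is the smallest open set containing $x$ and $cl(x)$ is the closure of $\{x\}$. A point of $\mathbb{K}^2$ is pure if its coordinates are both even or both odd, and mixed otherwise. $\Gamma:\mathbb{Z}^2\to\mathbb{K}^2$ is $\Gamma(x,y)=(x+y,y-x)$. For $A\subseteq\mathbb{Z}^2$, $$\Gamma^*(A)=\Gamma(A)\cup\{x\in\mathbb{K}^2: x\text{ is mixed and } N(x)\subseteq\Gamma(A)\cup\{x\}\text{ or } cl(x)\subseteq\Gamma(A)\cup\{x\}\}.$$ *)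

theory Defs
  imports "HOL-Analysis.Analysis"
begin

definition adjacent8 :: "int \<times> int \<Rightarrow> int \<times> int \<Rightarrow> bool" where
  "adjacent8 p q \<longleftrightarrow> p \<noteq> q \<and> \<bar>fst p - fst q\<bar> \<le> 1 \<and> \<bar>snd p - snd q\<bar> \<le> 1"

definition connected8 :: "(int \<times> int) set \<Rightarrow> bool" where
  "connected8 S \<longleftrightarrow>
     \<not> (\<exists>P Q. P \<noteq> {} \<and> Q \<noteq> {} \<and> P \<inter> Q = {} \<and> P \<union> Q = S \<and>
            (\<forall>p\<in>P. \<forall>q\<in>Q. \<not> adjacent8 p q))"

definition khalimsky_nbhd :: "int \<Rightarrow> int set" where
  "khalimsky_nbhd n = (if odd n then {n} else {n - 1, n, n + 1})"

text \<open>The Khalimsky topology is a value of type \<^typ>\<open>int topology\<close>; it is unrelated to the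
  discrete topology that the type class instance for \<^typ>\<open>int\<close> provides.\<close>

definition khalimsky :: "int topology" where
  "khalimsky = topology_generated_by (range khalimsky_nbhd)"

definition khalimsky2 :: "(int \<times> int) topology" where
  "khalimsky2 = prod_topology khalimsky khalimsky"

text \<open>The smallest open set containing \<open>x\<close>, given as the intersection of all open sets
  containing \<open>x\<close>; the lemma \<open>min_nbhd_smallest_open\<close> below shows that it is itself open.\<close>

definition min_nbhd :: "int \<times> int \<Rightarrow> (int \<times> int) set" where
  "min_nbhd x = \<Inter> {U. openin khalimsky2 U \<and> x \<in> U}"

definition pure_point :: "int \<times> int \<Rightarrow> bool" where
  "pure_point x \<longleftrightarrow> (even (fst x) \<and> even (snd x)) \<or> (odd (fst x) \<and> odd (snd x))"

definition mixed_point :: "int \<times> int \<Rightarrow> bool" where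
  "mixed_point x \<longleftrightarrow> \<not> pure_point x"

definition Gam :: "int \<times> int \<Rightarrow> int \<times> int" where
  "Gam = (\<lambda>(x, y). (x + y, y - x))"

definition Gam_star :: "(int \<times> int) set \<Rightarrow> (int \<times> int) set" where
  "Gam_star A = Gam ` A \<union>
     {x. mixed_point x \<and>
         (min_nbhd x \<subseteq> Gam ` A \<union> {x} \<or> khalimsky2 closure_of {x} \<subseteq> Gam ` A \<union> {x})}"

lemma topspace_khalimsky [simp]: "topspace khalimsky = UNIV"
  by (auto simp: khalimsky_def khalimsky_nbhd_def)

lemma topspace_khalimsky2 [simp]: "topspace khalimsky2 = UNIV"
  by (simp add: khalimsky2_def)

lemma openin_khalimsky_nbhd: "openin khalimsky (khalimsky_nbhd n)"
  unfolding khalimsky_def by (rule topology_generated_by_Basis) simp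

lemma khalimsky_nbhd_least:
  assumes "openin khalimsky U" "n \<in> U"
  shows "khalimsky_nbhd n \<subseteq> U"
proof -
  have "generate_topology_on (range khalimsky_nbhd) U"
    using assms(1) by (simp add: khalimsky_def openin_topology_generated_by_iff)
  then show ?thesis using assms(2)
  proof (induction rule: generate_topology_on.induct)
    case (UN K)
    then show ?case by blast
  qed (auto simp: khalimsky_nbhd_def split: if_splits)
qed

lemma min_nbhd_eq: "min_nbhd (a, b) = khalimsky_nbhd a \<times> khalimsky_nbhd b"
proof
  have "openin khalimsky2 (khalimsky_nbhd a \<times> khalimsky_nbhd b)"
    by (simp add: khalimsky2_def openin_prod_Times_iff openin_khalimsky_nbhd)
  moreover have "(a, b) \<in> khalimsky_nbhd a \<times> khalimsky_nbhd b"
    by (simp add: khalimsky_nbhd_def)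
  ultimately show "min_nbhd (a, b) \<subseteq> khalimsky_nbhd a \<times> khalimsky_nbhd b"
    unfolding min_nbhd_def by blast
  have "khalimsky_nbhd a \<times> khalimsky_nbhd b \<subseteq> W"
    if W: "openin khalimsky2 W" and ab: "(a, b) \<in> W" for W
  proof -
    obtain U V where "openin khalimsky U" "openin khalimsky V" "a \<in> U" "b \<in> V" "U \<times> V \<subseteq> W"
      using W ab unfolding khalimsky2_def openin_prod_topology_alt by metis
    then show ?thesis
      using khalimsky_nbhd_least by (meson Sigma_mono order_trans)
  qed
  then show "khalimsky_nbhd a \<times> khalimsky_nbhd b \<subseteq> min_nbhd (a, b)"
    unfolding min_nbhd_def by blast
qed

lemma min_nbhd_smallest_open:
  "openin khalimsky2 (min_nbhd x)" "x \<in> min_nbhd x"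
  "openin khalimsky2 U \<Longrightarrow> x \<in> U \<Longrightarrow> min_nbhd x \<subseteq> U"
proof -
  show "openin khalimsky2 (min_nbhd x)"
    by (cases x) (simp add: min_nbhd_eq khalimsky2_def openin_prod_Times_iff openin_khalimsky_nbhd)
  show "x \<in> min_nbhd x" "openin khalimsky2 U \<Longrightarrow> x \<in> U \<Longrightarrow> min_nbhd x \<subseteq> U"
    unfolding min_nbhd_def by auto
qed

end

theory Submission
  imports Defs
begin

text \<open>Mixed points of the Khalimsky plane correspond to unit squares of the integer grid: the
  smallest neighbourhood and the closure of a mixed point consist of the point itself and the
  \<open>Gam\<close>-images of the two ends of one or the other diagonal of its square. Hence a mixed point
  lies in \<open>Gam_star A\<close> iff \<open>A\<close> contains a diagonal of its square. In an Alexandrov space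
  connectedness only depends on comparability in the specialization preorder; two images of
  grid points are comparable iff the grid points are equal or 4-adjacent, and the mixed points
  of \<open>Gam_star A\<close> supply the missing links for diagonal 8-adjacency. Conversely, any two corners
  of a unit square are 8-adjacent, so that the mixed points create no further links.\<close>

definition comparable :: "int \<times> int \<Rightarrow> int \<times> int \<Rightarrow> bool" where
  "comparable x y \<longleftrightarrow> y \<in> min_nbhd x \<or> x \<in> min_nbhd y"

definition square_center :: "int \<times> int \<Rightarrow> int \<times> int" where
  "square_center = (\<lambda>(x, y). (x + y + 1, y - x))"

definition has_diagonal :: "(int \<times> int) set \<Rightarrow> int \<times> int \<Rightarrow> bool" where
  "has_diagonal A = (\<lambda>(x, y).
     (x, y) \<in> A \<and> (x + 1, y + 1) \<in> A \<or> (x, y + 1) \<in> A \<and> (x + 1, y) \<in> A)"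

definition corners :: "int \<times> int \<Rightarrow> (int \<times> int) set" where
  "corners = (\<lambda>(x, y). {(x, y), (x + 1, y), (x, y + 1), (x + 1, y + 1)})"

section \<open>Connectedness through comparability\<close>

lemma comparable_sym: "comparable x y \<longleftrightarrow> comparable y x"
  by (auto simp: comparable_def)

text \<open>An open set contains \<open>min_nbhd\<close> of each of its points, so a topological
  separation leaves no comparable pair across. Conversely, unions of smallest neighbourhoods are
  open and separate the pieces. This gives connectedness the same form as
  \<open>connected8\<close>.\<close>

lemma connectedin_khalimsky2_iff:
  "connectedin khalimsky2 S \<longleftrightarrow>
     \<not> (\<exists>P Q. P \<noteq> {} \<and> Q \<noteq> {} \<and> P \<inter> Q = {} \<and> P \<union> Q = S \<and>
            (\<forall>p\<in>P. \<forall>q\<in>Q. \<not> comparable p q))" (is "_ \<longleftrightarrow> \<not> ?sep")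
proof -
  let ?opensep = "\<exists>E F. openin khalimsky2 E \<and> openin khalimsky2 F \<and> S \<subseteq> E \<union> F \<and>
      E \<inter> F \<inter> S = {} \<and> E \<inter> S \<noteq> {} \<and> F \<inter> S \<noteq> {}"
  have ?sep if E: "openin khalimsky2 E" "openin khalimsky2 F" "S \<subseteq> E \<union> F"
      "E \<inter> F \<inter> S = {}" "E \<inter> S \<noteq> {}" "F \<inter> S \<noteq> {}" for E F
  proof (intro exI conjI ballI)
    fix p q assume p: "p \<in> E \<inter> S" and q: "q \<in> F \<inter> S"
    have "min_nbhd p \<subseteq> E" "min_nbhd q \<subseteq> F"
      using p q E(1,2) min_nbhd_smallest_open(3) by auto
    moreover have "q \<notin> E" "p \<notin> F"
      using p q E(4) by auto
    ultimately show "\<not> comparable p q"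
      unfolding comparable_def by auto
  qed (use E in auto)
  then have "?sep" if ?opensep
    using that by (elim exE conjE)
  moreover have ?opensep if ?sep
  proof -
    obtain P Q where PQ: "P \<noteq> {}" "Q \<noteq> {}" "P \<inter> Q = {}" "P \<union> Q = S"
      and sep: "\<And>p q. p \<in> P \<Longrightarrow> q \<in> Q \<Longrightarrow> \<not> comparable p q"
      using \<open>?sep\<close> by blast
    \<comment> \<open>These open sets may overlap, but only outside \<open>S\<close>, which
      \<open>connectedin\<close> allows.\<close>
    let ?E = "\<Union>(min_nbhd ` P)" and ?F = "\<Union>(min_nbhd ` Q)"
    have sub: "P \<subseteq> ?E" "Q \<subseteq> ?F"
      using min_nbhd_smallest_open(2) by auto
    have "?E \<inter> Q = {}" "?F \<inter> P = {}"
      using sep unfolding comparable_def by blast+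
    then have "?E \<inter> ?F \<inter> S = {}"
      using PQ by blast
    moreover have "openin khalimsky2 ?E" "openin khalimsky2 ?F"
      by (auto intro!: openin_Union min_nbhd_smallest_open)
    moreover have "S \<subseteq> ?E \<union> ?F" "?E \<inter> S \<noteq> {}" "?F \<inter> S \<noteq> {}"
      using PQ sub by auto
    ultimately show ?thesis
      by (intro exI[of _ ?E] exI[of _ ?F] conjI)
  qed
  ultimately have "?opensep \<longleftrightarrow> ?sep"
    by (rule iffI)
  then show ?thesis
    unfolding connectedin topspace_khalimsky2 by (simp only: subset_UNIV simp_thms)
qed

lemma closure_of_singleton: "khalimsky2 closure_of {x} = {y. x \<in> min_nbhd y}"
  by (auto simp: in_closure_of min_nbhd_def)

section \<open>Mixed points as centres of unit squares\<close>

lemma inj_Gam: "inj Gam"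
  by (auto simp: inj_def Gam_def)

lemma inj_square_center: "inj square_center"
  by (auto simp: inj_def square_center_def)

lemma mixed_point_iff_odd: "mixed_point x \<longleftrightarrow> odd (fst x + snd x)"
  by (auto simp: mixed_point_def pure_point_def)

lemma Gam_neq_square_center: "Gam p \<noteq> square_center s"
proof -
  have "even (fst (Gam p) + snd (Gam p))"
    by (cases p) (simp add: Gam_def)
  moreover have "odd (fst (square_center s) + snd (square_center s))"
    by (cases s) (simp add: square_center_def)
  ultimately show ?thesis by metis
qed

lemma mixed_point_iff: "mixed_point x \<longleftrightarrow> x \<in> range square_center"
proof
  assume "mixed_point x"
  then obtain k where k: "fst x + snd x = 2 * k + 1"
    unfolding mixed_point_iff_odd by (rule oddE)
  \<comment> \<open>Solving \<open>square_center (a, b) = x\<close>: the coordinates of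
    \<open>x\<close> add up to \<open>2 * b + 1\<close>, so \<open>b = k\<close>, and the second one
    is \<open>b - a\<close>.\<close>
  then have "x = square_center (k - snd x, k)"
    by (simp add: square_center_def prod_eq_iff)
  then show "x \<in> range square_center" by blast
next
  show "x \<in> range square_center \<Longrightarrow> mixed_point x"
    by (auto simp: mixed_point_iff_odd square_center_def)
qed

lemma khalimsky_nbhd_converse:
  "{m. n \<in> khalimsky_nbhd m} = (if odd n then {n - 1, n, n + 1} else {n})"
  by (auto simp: khalimsky_nbhd_def)

text \<open>One coordinate of a mixed point is even, and the neighbourhood is the segment of three
  points in that direction. The parity of \<open>x + y\<close> decides which one it is, hence which
  diagonal appears; the closure takes the other.\<close>

lemma min_nbhd_square_center:
  "min_nbhd (square_center (x, y)) = insert (square_center (x, y))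
     (if even (x + y) then {Gam (x, y + 1), Gam (x + 1, y)} else {Gam (x, y), Gam (x + 1, y + 1)})"
  by (auto simp: square_center_def Gam_def min_nbhd_eq khalimsky_nbhd_def)

lemma closure_of_square_center:
  "khalimsky2 closure_of {square_center (x, y)} = insert (square_center (x, y))
     (if even (x + y) then {Gam (x, y), Gam (x + 1, y + 1)} else {Gam (x, y + 1), Gam (x + 1, y)})"
proof -
  have "khalimsky2 closure_of {(a, b)} =
      {m. a \<in> khalimsky_nbhd m} \<times> {m. b \<in> khalimsky_nbhd m}" for a b
    by (auto simp: closure_of_singleton min_nbhd_eq)
  then show ?thesis
    by (auto simp: square_center_def Gam_def khalimsky_nbhd_converse)
qed

text \<open>The parity dependence cancels: the disjunction in \<open>Gam_star\<close> covers both
  diagonals in either case.\<close>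

lemma Gam_star_eq: "Gam_star A = Gam ` A \<union> square_center ` {s. has_diagonal A s}"
proof -
  have "min_nbhd (square_center s) \<subseteq> Gam ` A \<union> {square_center s} \<or>
        khalimsky2 closure_of {square_center s} \<subseteq> Gam ` A \<union> {square_center s}
        \<longleftrightarrow> has_diagonal A s" for s
    by (cases s) (auto simp: min_nbhd_square_center closure_of_square_center has_diagonal_def
        inj_image_mem_iff[OF inj_Gam] Gam_neq_square_center)
  then show ?thesis
    unfolding Gam_star_def mixed_point_iff by blast
qed

section \<open>Comparability of pure and mixed points\<close>

lemma Gam_in_min_nbhd_Gam:
  "Gam (u, v) \<in> min_nbhd (Gam (x, y)) \<longleftrightarrow>
     (u, v) = (x, y) \<or> even (x + y) \<and> \<bar>x - u\<bar> + \<bar>y - v\<bar> \<le> 1"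
proof (cases "even (x + y)")
  case True
  then have "even (y - x)" by simp
  have nbhd: "m \<in> khalimsky_nbhd n \<longleftrightarrow> \<bar>m - n\<bar> \<le> 1" if "even n" for m n
    using that by (auto simp: khalimsky_nbhd_def)
  have "Gam (u, v) \<in> min_nbhd (Gam (x, y)) \<longleftrightarrow>
      \<bar>(u + v) - (x + y)\<bar> \<le> 1 \<and> \<bar>(v - u) - (y - x)\<bar> \<le> 1"
    by (simp only: Gam_def prod.case min_nbhd_eq mem_Times_iff fst_conv snd_conv
        nbhd[OF True] nbhd[OF \<open>even (y - x)\<close>])
  \<comment> \<open>\<open>Gam\<close> turns the unit ball of the taxicab norm into that of the
    maximum norm.\<close>
  also have "\<dots> \<longleftrightarrow> \<bar>x - u\<bar> + \<bar>y - v\<bar> \<le> 1"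
    by linarith
  finally show ?thesis
    using True by auto
next
  case False
  then have "odd (y - x)" by simp
  with False have "Gam (u, v) \<in> min_nbhd (Gam (x, y)) \<longleftrightarrow> Gam (u, v) = Gam (x, y)"
    by (simp add: Gam_def min_nbhd_eq khalimsky_nbhd_def)
  then show ?thesis
    using False by (simp add: inj_eq[OF inj_Gam])
qed

lemma comparable_Gam_Gam:
  "comparable (Gam p) (Gam q) \<longleftrightarrow> \<bar>fst p - fst q\<bar> + \<bar>snd p - snd q\<bar> \<le> 1"
proof (cases p; cases q)
  fix x y u v assume [simp]: "p = (x, y)" "q = (u, v)"
  have "u = x \<and> v = y \<or> even (x + y) \<or> even (u + v)" if "\<bar>x - u\<bar> + \<bar>y - v\<bar> \<le> 1"
  proof -
    \<comment> \<open>A unit step changes the parity of the coordinate sum, so one of two 4-adjacent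
      points has an even sum and its neighbourhood reaches the other.\<close>
    have "u = x \<and> v = y \<or> u + v = x + y + 1 \<or> u + v = x + y - 1"
      using that by linarith
    then show ?thesis by presburger
  qed
  then show ?thesis
    by (auto simp: comparable_def Gam_in_min_nbhd_Gam abs_minus_commute)
qed

lemma comparable_Gam_square_center:
  "comparable (Gam p) (square_center s) \<longleftrightarrow> p \<in> corners s"
proof (cases s)
  case (Pair x y)
  have "comparable (Gam p) (square_center s) \<longleftrightarrow>
      Gam p \<in> min_nbhd (square_center s) \<union> khalimsky2 closure_of {square_center s}"
    by (auto simp: comparable_def closure_of_singleton)
  also have "\<dots> \<longleftrightarrow> p \<in> corners s"
    by (auto simp: Pair min_nbhd_square_center closure_of_square_center corners_def
        Gam_neq_square_center inj_eq[OF inj_Gam])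
  finally show ?thesis .
qed

text \<open>All other points in the smallest neighbourhood of a mixed point are pure.\<close>

lemma comparable_square_center_square_center:
  "comparable (square_center s) (square_center t) \<longleftrightarrow> s = t"
proof -
  have "square_center s \<in> min_nbhd (square_center t) \<longleftrightarrow> s = t" for s t
    by (cases t) (auto simp: min_nbhd_square_center inj_eq[OF inj_square_center]
        Gam_neq_square_center[symmetric])
  then show ?thesis by (auto simp: comparable_def)
qed

lemma corners_adjacent8: "p \<in> corners s \<Longrightarrow> q \<in> corners s \<Longrightarrow> p = q \<or> adjacent8 p q"
  by (auto simp: corners_def adjacent8_def split: prod.splits)

lemma has_diagonal_corner: "has_diagonal A s \<Longrightarrow> \<exists>p. p \<in> A \<and> p \<in> corners s"
  by (auto simp: has_diagonal_def corners_def split: prod.splits)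

lemma adjacent8_cases:
  assumes "adjacent8 p q"
  obtains "comparable (Gam p) (Gam q)"
    | s where "p \<in> corners s" "q \<in> corners s"
        "\<And>A. p \<in> A \<Longrightarrow> q \<in> A \<Longrightarrow> has_diagonal A s"
proof (cases "comparable (Gam p) (Gam q)")
  case False
  obtain x y u v where [simp]: "p = (x, y)" "q = (u, v)"
    by (cases p, cases q)
  have "(u = x + 1 \<or> u = x - 1) \<and> (v = y + 1 \<or> v = y - 1)"
    using False assms by (auto simp: comparable_Gam_Gam adjacent8_def)
  then show ?thesis
    \<comment> \<open>Whichever diagonal \<open>p\<close> and \<open>q\<close> span, the
      componentwise minimum is the lower left corner of their square.\<close>
    by (intro that(2)[of "(min x u, min y v)"]) (auto simp: corners_def has_diagonal_def)
qed

text \<open>A separation of \<open>Gam_star A\<close> pulls back along \<open>Gam\<close> to one of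
  \<open>A\<close>.\<close>

lemma connectedin_Gam_star:
  assumes "connected8 A"
  shows "connectedin khalimsky2 (Gam_star A)"
  unfolding connectedin_khalimsky2_iff
proof clarify
  fix P Q assume "P \<noteq> {}" "Q \<noteq> {}" "P \<inter> Q = {}" and PQ: "P \<union> Q = Gam_star A"
    and sep: "\<forall>p\<in>P. \<forall>q\<in>Q. \<not> comparable p q"
  let ?P = "{p \<in> A. Gam p \<in> P}" and ?Q = "{p \<in> A. Gam p \<in> Q}"
  have sep': "\<not> comparable x y" if "x \<in> P \<and> y \<in> Q \<or> x \<in> Q \<and> y \<in> P" for x y
    using that sep comparable_sym by blast
  have GA: "Gam p \<in> P \<union> Q" if "p \<in> A" for p
    using that PQ by (auto simp: Gam_star_eq)
  \<comment> \<open>Ensures that neither pulled-back piece is empty, even if \<open>P\<close> or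
    \<open>Q\<close> were to consist of mixed points only.\<close>
  have link: "\<exists>p\<in>A. comparable (Gam p) x" if x: "x \<in> P \<union> Q" for x
  proof -
    consider p where "p \<in> A" "x = Gam p" | s where "has_diagonal A s" "x = square_center s"
      using x unfolding PQ Gam_star_eq by blast
    then show ?thesis
      using has_diagonal_corner comparable_Gam_square_center min_nbhd_smallest_open(2)
      unfolding comparable_def by cases blast+
  qed
  have "?P \<noteq> {}" "?Q \<noteq> {}"
    using \<open>P \<noteq> {}\<close> \<open>Q \<noteq> {}\<close> link GA sep' by blast+
  moreover have "?P \<inter> ?Q = {}" "?P \<union> ?Q = A"
    using \<open>P \<inter> Q = {}\<close> GA by blast+
  moreover have "\<not> adjacent8 p q" if "p \<in> ?P" "q \<in> ?Q" for p q
  proof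
    assume "adjacent8 p q"
    then show False
    proof (cases rule: adjacent8_cases)
      case 1
      then show False using that sep by blast
    next
      case (2 s)
      \<comment> \<open>The centre is comparable to both \<open>Gam p\<close> and
        \<open>Gam q\<close>, so it fits into neither piece.\<close>
      then have "square_center s \<in> P \<union> Q"
        using that unfolding PQ Gam_star_eq by blast
      then show False
        using 2 that sep' comparable_Gam_square_center by blast
    qed
  qed
  ultimately have "\<exists>P Q. P \<noteq> {} \<and> Q \<noteq> {} \<and> P \<inter> Q = {} \<and> P \<union> Q = A \<and>
      (\<forall>p\<in>P. \<forall>q\<in>Q. \<not> adjacent8 p q)"
    by (intro exI[of _ ?P] exI[of _ ?Q] conjI ballI)
  with assms[unfolded connected8_def] show False ..
qed

lemma connected8_if_connectedin_Gam_star: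
  assumes "connectedin khalimsky2 (Gam_star A)"
  shows "connected8 A"
  unfolding connected8_def
proof clarify
  fix P Q assume "P \<noteq> {}" "Q \<noteq> {}" and PQ: "P \<inter> Q = {}" "A = P \<union> Q"
    and sep: "\<forall>p\<in>P. \<forall>q\<in>Q. \<not> adjacent8 p q"
  have no_common_square: False
    if "p \<in> P" "q \<in> Q" "p \<in> corners s" "q \<in> corners s" for p q s
    using corners_adjacent8[OF that(3,4)] that PQ(1) sep by blast
  \<comment> \<open>The ends of a diagonal are 8-adjacent, so they lie in the same piece. Hence
    \<open>Gam_star\<close> maps the separation of \<open>A\<close> to a covering of
    \<open>Gam_star A\<close> by two sets.\<close>
  have diag: "has_diagonal (P \<union> Q) s \<longleftrightarrow> has_diagonal P s \<or> has_diagonal Q s" for s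
  proof (cases s)
    case (Pair x y)
    show ?thesis
      using no_common_square[of _ _ s] unfolding Pair has_diagonal_def corners_def by auto
  qed
  have "Gam_star P \<noteq> {}" "Gam_star Q \<noteq> {}"
    using \<open>P \<noteq> {}\<close> \<open>Q \<noteq> {}\<close> by (auto simp: Gam_star_eq)
  moreover have "Gam_star P \<union> Gam_star Q = Gam_star A"
    by (auto simp: Gam_star_eq PQ diag)
  moreover have incomp: "\<not> comparable x y" if xy: "x \<in> Gam_star P" "y \<in> Gam_star Q" for x y
  proof
    assume c: "comparable x y"
    consider p q where "x = Gam p" "p \<in> P" "y = Gam q" "q \<in> Q"
      | p t where "x = Gam p" "p \<in> P" "y = square_center t" "has_diagonal Q t"
      | s q where "x = square_center s" "has_diagonal P s" "y = Gam q" "q \<in> Q"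
      | s t where "x = square_center s" "has_diagonal P s" "y = square_center t" "has_diagonal Q t"
      using xy unfolding Gam_star_eq by blast
    then show False
    proof cases
      case 1
      then have "p = q \<or> adjacent8 p q"
        using c by (auto simp: comparable_Gam_Gam adjacent8_def)
      then show False using 1 PQ sep by blast
    next
      case 2
      then show False
        using c has_diagonal_corner no_common_square comparable_Gam_square_center by metis
    next
      case 3
      then show False
        using c has_diagonal_corner no_common_square comparable_Gam_square_center comparable_sym
        by metis
    next
      case 4
      \<comment> \<open>Here \<open>s = t\<close>, so a single square would have corners in both
        \<open>P\<close> and \<open>Q\<close>.\<close>
      then show False
        using c has_diagonal_corner no_common_square comparable_square_center_square_center by metis
    qed
  qed
  \<comment> \<open>A common point would be comparable to itself.\<close>
  moreover have "Gam_star P \<inter> Gam_star Q = {}"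
    using incomp min_nbhd_smallest_open(2) unfolding comparable_def by blast
  ultimately have "\<exists>P Q. P \<noteq> {} \<and> Q \<noteq> {} \<and> P \<inter> Q = {} \<and> P \<union> Q = Gam_star A \<and>
      (\<forall>p\<in>P. \<forall>q\<in>Q. \<not> comparable p q)"
    by (intro exI[of _ "Gam_star P"] exI[of _ "Gam_star Q"] conjI ballI)
  with assms[unfolded connectedin_khalimsky2_iff] show False ..
qed

theorem theorem5p3:
  fixes A :: "(int \<times> int) set"
  shows "connected8 A \<longleftrightarrow> connectedin khalimsky2 (Gam_star A)"
  using connectedin_Gam_star connected8_if_connectedin_Gam_star by blast

end
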